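(* Let $\mathcal B$ be a basis of $\mathbb X$ that has the $\mathbf n$-UL property with constants $\mathbf C_1$ and $\mathbf C_2$. The following hold: (i) If $\mathbf n$ has $l$-bounded additive gaps, then $\mathcal B$ has the UL property with constants $\mathbf C_1',\mathbf C_2'$ satisfying $$\mathbf C_1'\le\max\{(n_1-1)\alpha_1\alpha_2,\ \mathbf C_1+l\alpha_1\alpha_2+\mathbf C_1l\alpha_1\alpha_2\},\qquad \mathbf C_2'\le\max\{(n_1-1)\alpha_1\alpha_2,\ \mathbf C_2+l\alpha_1\alpha_2+\mathbf C_2l\alpha_1\alpha_2\}.$$ (ii) If $\mathbf n$ has $l$-bounded quotient gaps and $\mathcal B$ is Schauder with basis constant $\mathbf K$, then $\mathcal B$ has the UL property with constants $\mathbf C_1',\mathbf C_2'$ satisfying $$\mathbf C_1'\le\max\{(n_1-1)\alpha_1\alpha_2,\ \mathbf K^2\mathbf C_1+2(l-1)\mathbf C_1\mathbf K\},\qquad \mathbf C_2'\le\max\{(n_1-1)\alpha_1\alpha_2,\ \mathbf K^2\mathbf C_2+2(l-1)\mathbf C_2\mathbf K\}.$$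
   Context: $\mathbb X$ is a separable infinite-dimensional Banach space over $\mathbb F=\mathbb R$ or $\mathbb C$, with dual $\mathbb X^*$. A basis of $\mathbb X$ is a sequence $\mathcal B=(\mathbf e_i)_{i\in\mathbb N}\subset\mathbb X$ with closed linear span $\mathbb X$, having a (unique) sequence of biorthogonal functionals $(\mathbf e_i^* )_{i\in\mathbb N}\subset\mathbb X^*$ ($\mathbf e_k^*(\mathbf e_i)=\delta_{k,i}$), with $0<\inf_i\min\{\|\mathbf e_i\|,\|\mathbf e_i^*\|\}\le\sup_i\max\{\|\mathbf e_i\|,\|\mathbf e_i^*\|\}<\infty$. Put $\alpha_1=\sup_i\|\mathbf e_i\|$, $\alpha_2=\sup_i\|\mathbf e_i^*\|$. The basis is Schauder if it is total ($\mathbf e_i^*(x)=0$ for all $i$ implies $x=0$) and there is $\mathbf C>0$ with $\|\sum_{i=1}^m\mathbf e_i^*(x)\mathbf e_i\|\le\mathbf C\|x\|$ for all $x\in\mathbb X$, $m\in\mathbb N$; the least such $\mathbf C$ is its basis constant. $\mathbf n=(n_k)_{k\in\mathbb N}$ is a strictly increasing sequence of positive integers, also regarded as a subset of $\mathbb N$ ($\mathbf n=\mathbb N$ is allowed). For an integer $l\ge2$, $\mathbf n$ has $l$-bounded additive gaps if $n_{k+1}-n_k\le l$ for all $k$, and $l$-bounded quotient gaps if $n_{k+1}/n_k\le l$ for all $k$. For a finite $A\subset\mathbb N$, $\mathbf 1_A=\sum_{n\in A}\mathbf e_n$. $\mathcal B$ has the $\mathbf n$-UL property with constants $\mathbf C_1,\mathbf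 C_2>0$ if $$\frac1{\mathbf C_1}\min_{i\in A}|a_i|\,\|\mathbf 1_A\|\le\Big\|\sum_{i\in A}a_i\mathbf e_i\Big\|\le\mathbf C_2\max_{i\in A}|a_i|\,\|\mathbf 1_A\|$$ for all $A\subset\mathbb N$ with $|A|\in\mathbf n$ and all scalars $(a_i)_{i\in A}$. For $\mathbf n=\mathbb N$ this is called the UL property with constants $\mathbf C_1,\mathbf C_2$. *)

theory Defs
  imports "HOL-Analysis.Analysis"
begin

text \<open>
  A Banach space over \<open>\<real>\<close> or \<open>\<complex>\<close> is a type of class \<open>banach\<close> with a scalar multiplication by a
  type \<open>'f\<close> of class \<open>real_normed_field\<close>. By the Gelfand-Mazur theorem, the types of this
  class are, up to isometric isomorphism, exactly the real and the complex numbers (the class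
  requires a multiplicative norm).
  The second assumption makes the two scalar multiplications agree on real scalars;
  for \<open>'f = real\<close> it forces \<open>scl = (*\<^sub>R)\<close>.
\<close>

locale banach_space_over = vector_space scl
  for scl :: "'f::real_normed_field \<Rightarrow> 'x::banach \<Rightarrow> 'x" +
  assumes norm_scl: "norm (scl c x) = norm c * norm x"
    and scl_of_real: "scl (of_real r) x = r *\<^sub>R x"

locale separable_inf_dim_banach_space = banach_space_over scl
  for scl :: "'f::real_normed_field \<Rightarrow> 'x::banach \<Rightarrow> 'x" +
  assumes separable: "\<exists>D :: 'x set. countable D \<and> closure D = UNIV"
    and infinite_dimensional: "\<not> (\<exists>B. finite B \<and> span B = UNIV)"

text \<open>Since \<open>scl\<close> extends \<open>(*\<^sub>R)\<close>, the norm on the dual space is the library's \<open>onorm\<close>.\<close>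

definition in_dual :: "('f::real_normed_field \<Rightarrow> 'x::banach \<Rightarrow> 'x) \<Rightarrow> ('x \<Rightarrow> 'f) \<Rightarrow> bool" where
  "in_dual scl f \<longleftrightarrow> Vector_Spaces.linear scl (*) f \<and> bounded_linear f"

text \<open>
  Sequences are indexed from \<open>0\<close>. The biorthogonal functionals \<open>es\<close> are an explicit argument;
  density of the span of the \<open>e i\<close> makes them unique.
\<close>

definition is_basis ::
  "('f::real_normed_field \<Rightarrow> 'x::banach \<Rightarrow> 'x) \<Rightarrow> (nat \<Rightarrow> 'x) \<Rightarrow> (nat \<Rightarrow> 'x \<Rightarrow> 'f) \<Rightarrow> bool" where
  "is_basis scl e es \<longleftrightarrow>
     closure (module.span scl (range e)) = UNIV \<and>
     (\<forall>k. in_dual scl (es k)) \<and>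
     (\<forall>k i. es k (e i) = (if k = i then 1 else 0)) \<and>
     0 < (INF i. min (norm (e i)) (onorm (es i))) \<and>
     bdd_above (range (\<lambda>i. max (norm (e i)) (onorm (es i))))"

definition alpha1 :: "(nat \<Rightarrow> 'x::banach) \<Rightarrow> real" where
  "alpha1 e = (SUP i. norm (e i))"

definition alpha2 :: "(nat \<Rightarrow> 'x::banach \<Rightarrow> 'f::real_normed_field) \<Rightarrow> real" where
  "alpha2 es = (SUP i. onorm (es i))"

definition partial_sum_bound ::
  "('f::real_normed_field \<Rightarrow> 'x::banach \<Rightarrow> 'x) \<Rightarrow> (nat \<Rightarrow> 'x) \<Rightarrow> (nat \<Rightarrow> 'x \<Rightarrow> 'f) \<Rightarrow> real \<Rightarrow> bool" where
  "partial_sum_bound scl e es C \<longleftrightarrow>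
     0 < C \<and> (\<forall>x m. norm (\<Sum>i<m. scl (es i x) (e i)) \<le> C * norm x)"

definition is_schauder ::
  "('f::real_normed_field \<Rightarrow> 'x::banach \<Rightarrow> 'x) \<Rightarrow> (nat \<Rightarrow> 'x) \<Rightarrow> (nat \<Rightarrow> 'x \<Rightarrow> 'f) \<Rightarrow> bool" where
  "is_schauder scl e es \<longleftrightarrow>
     is_basis scl e es \<and> (\<forall>x. (\<forall>i. es i x = 0) \<longrightarrow> x = 0) \<and> (\<exists>C. partial_sum_bound scl e es C)"

definition is_basis_constant ::
  "('f::real_normed_field \<Rightarrow> 'x::banach \<Rightarrow> 'x) \<Rightarrow> (nat \<Rightarrow> 'x) \<Rightarrow> (nat \<Rightarrow> 'x \<Rightarrow> 'f) \<Rightarrow> real \<Rightarrow> bool" where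
  "is_basis_constant scl e es K \<longleftrightarrow>
     partial_sum_bound scl e es K \<and> (\<forall>C. partial_sum_bound scl e es C \<longrightarrow> K \<le> C)"

definition bounded_additive_gaps :: "nat \<Rightarrow> (nat \<Rightarrow> nat) \<Rightarrow> bool" where
  "bounded_additive_gaps l n \<longleftrightarrow> (\<forall>k. real (n (Suc k)) - real (n k) \<le> real l)"

definition bounded_quotient_gaps :: "nat \<Rightarrow> (nat \<Rightarrow> nat) \<Rightarrow> bool" where
  "bounded_quotient_gaps l n \<longleftrightarrow> (\<forall>k. real (n (Suc k)) / real (n k) \<le> real l)"

text \<open>
  \<open>N\<close> is meant to be a set of positive integers, so that only nonempty \<open>A\<close> are considered
  and \<open>Min\<close> and \<open>Max\<close> are taken over nonempty finite sets.
\<close>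

definition UL_on ::
  "('f::real_normed_field \<Rightarrow> 'x::banach \<Rightarrow> 'x) \<Rightarrow> (nat \<Rightarrow> 'x) \<Rightarrow> nat set \<Rightarrow> real \<Rightarrow> real \<Rightarrow> bool" where
  "UL_on scl e N C1 C2 \<longleftrightarrow> 0 < C1 \<and> 0 < C2 \<and>
     (\<forall>A a. finite A \<and> card A \<in> N \<longrightarrow>
        1 / C1 * Min ((\<lambda>i. norm (a i)) ` A) * norm (\<Sum>i\<in>A. e i)
          \<le> norm (\<Sum>i\<in>A. scl (a i) (e i)) \<and>
        norm (\<Sum>i\<in>A. scl (a i) (e i))
          \<le> C2 * Max ((\<lambda>i. norm (a i)) ` A) * norm (\<Sum>i\<in>A. e i))"

definition UL ::
  "('f::real_normed_field \<Rightarrow> 'x::banach \<Rightarrow> 'x) \<Rightarrow> (nat \<Rightarrow> 'x) \<Rightarrow> real \<Rightarrow> real \<Rightarrow> bool" where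
  "UL scl e C1 C2 \<longleftrightarrow> UL_on scl e {1..} C1 C2"

end

theory Submission
  imports Defs
begin

text \<open>
  The two inequalities of the UL property are instances of one comparison. Write \<open>x\<^sub>A = \<Sum>\<^sub>A a\<^sub>i e\<^sub>i\<close>
  and \<open>y\<^sub>A = \<Sum>\<^sub>A b\<^sub>i e\<^sub>i\<close>, where \<open>|a\<^sub>i| \<le> d |b\<^sub>i|\<close> on \<open>A\<close>, and look for a constant \<open>C\<close> with
  \<open>\<parallel>x\<^sub>A\<parallel> \<le> C d \<parallel>y\<^sub>A\<parallel>\<close>. The upper inequality is the case \<open>b = 1\<close>, \<open>d = max |a\<^sub>i|\<close>; the lower one is the
  case where \<open>y\<close> carries the given scalars, \<open>x\<close> has all its coefficients equal to
  their minimum modulus, and \<open>d = 1\<close>. So it suffices to pass from the comparison on subsets of \<open>A\<close> of cardinality in \<open>n\<close> to the comparison on \<open>A\<close>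
  (\<open>UL_of_comparison\<close>). Put \<open>\<alpha> = \<alpha>\<^sub>1 \<alpha>\<^sub>2\<close>; there are three estimates.

  The triangle inequality, together with \<open>|b\<^sub>i| \<le> \<alpha>\<^sub>2 \<parallel>y\<^sub>A\<parallel>\<close>, always gives the constant \<open>|A| \<alpha>\<close>
  (\<open>norm_lincomb_le_card\<close>). This settles the sets with fewer elements than every member of \<open>n\<close>.

  With additive gaps, every larger set contains a \<open>B\<close> with \<open>|B| \<in> n\<close> that misses at most \<open>l\<close> of
  its elements. Passing from \<open>A\<close> to \<open>B\<close> costs \<open>l \<alpha>\<close>, and passing from \<open>y\<^sub>B\<close> back to \<open>y\<^sub>A\<close> costs
  a factor \<open>1 + l \<alpha>\<close> (\<open>norm_lincomb_le_remove\<close>).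

  With quotient gaps, a larger set \<open>A\<close> has \<open>m \<le> |A| < l m\<close> for some \<open>m \<in> n\<close>. Cut \<open>A\<close>, from left to
  right, into a head of fewer than \<open>m\<close> elements and at most \<open>l - 1\<close> consecutive blocks of exactly \<open>m\<close>
  elements. A block is cut out of \<open>A\<close> by a difference of two partial sum projections, which
  costs \<open>2K\<close>. The head is the initial segment of the set of the first \<open>m\<close> elements of \<open>A\<close>, itself
  an initial segment of \<open>A\<close>, which costs \<open>K\<^sup>2\<close> (\<open>norm_lincomb_le_blocks\<close>).
\<close>

section \<open>Finite linear combinations of a basis\<close>

locale basis_of_banach_space = banach_space_over scl
  for scl :: "'f::real_normed_field \<Rightarrow> 'x::banach \<Rightarrow> 'x" +
  fixes e :: "nat \<Rightarrow> 'x" and es :: "nat \<Rightarrow> 'x \<Rightarrow> 'f"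
  assumes basis: "is_basis scl e es"
begin

definition lincomb :: "(nat \<Rightarrow> 'f) \<Rightarrow> nat set \<Rightarrow> 'x" where
  "lincomb a A = (\<Sum>i\<in>A. scl (a i) (e i))"

lemma lincomb_one: "lincomb (\<lambda>_. 1) A = (\<Sum>i\<in>A. e i)"
  by (simp add: lincomb_def)

lemma lincomb_of_real: "lincomb (\<lambda>_. of_real r) A = r *\<^sub>R (\<Sum>i\<in>A. e i)"
  by (simp add: lincomb_def scl_of_real scaleR_sum_right)

lemma lincomb_split:
  assumes "finite A" "B \<subseteq> A"
  shows "lincomb a A = lincomb a (A - B) + lincomb a B"
  unfolding lincomb_def using sum.subset_diff[OF assms(2,1)] .

lemma norm_e_le: "norm (e i) \<le> alpha1 e"
proof -
  have "bdd_above (range (\<lambda>i. max (norm (e i)) (onorm (es i))))"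
    using basis by (simp add: is_basis_def)
  then have "bdd_above (range (\<lambda>i. norm (e i)))"
    unfolding bdd_above_def by auto
  then show ?thesis unfolding alpha1_def by (intro cSUP_upper) auto
qed

lemma bounded_linear_es: "bounded_linear (es i)"
  using basis by (simp add: is_basis_def in_dual_def)

lemma norm_es_le: "norm (es i x) \<le> alpha2 es * norm x"
proof -
  have "bdd_above (range (\<lambda>i. max (norm (e i)) (onorm (es i))))"
    using basis by (simp add: is_basis_def)
  then have "bdd_above (range (\<lambda>i. onorm (es i)))"
    unfolding bdd_above_def by auto
  then have "onorm (es i) \<le> alpha2 es"
    unfolding alpha2_def by (intro cSUP_upper) auto
  then show ?thesis
    using onorm[OF bounded_linear_es, of i x] by (meson mult_right_mono norm_ge_zero order_trans)
qed

lemma alpha1_nonneg: "0 \<le> alpha1 e"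
  using norm_e_le[of 0] norm_ge_zero[of "e 0"] by linarith

lemma alpha2_nonneg: "0 \<le> alpha2 es"
proof -
  have "es 0 (e 0) = 1" using basis by (simp add: is_basis_def)
  then have "0 < alpha2 es * norm (e 0)"
    using norm_es_le[of 0 "e 0"] by simp
  then show ?thesis by (simp add: zero_less_mult_iff)
qed

lemma es_lincomb:
  assumes "finite A"
  shows "es k (lincomb a A) = (if k \<in> A then a k else 0)"
proof -
  have lin: "Vector_Spaces.linear scl (*) (es k)"
    and bi: "\<And>i. es k (e i) = (if k = i then 1 else 0)"
    using basis by (auto simp: is_basis_def in_dual_def)
  interpret L: Vector_Spaces.linear scl "(*)" "es k" by (rule lin)
  show ?thesis
    using assms by (simp add: lincomb_def L.sum L.scale bi if_distrib cong: if_cong)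
qed

lemma norm_coeff_le:
  assumes "finite A" "i \<in> A"
  shows "norm (a i) \<le> alpha2 es * norm (lincomb a A)"
  using norm_es_le[of i "lincomb a A"] assms by (simp add: es_lincomb)

section \<open>Comparison by the triangle inequality\<close>

text \<open>
  The sum runs over a subset \<open>D\<close> while the majorant lives on all of \<open>A\<close>. With \<open>D = A\<close> this is the
  comparison on small sets; a proper subset is the part of \<open>A\<close> lost when \<open>A\<close> is
  trimmed to an admissible cardinality.
\<close>

lemma norm_lincomb_le_card:
  assumes "finite A" "D \<subseteq> A" "0 \<le> d"
    and dom: "\<And>i. i \<in> A \<Longrightarrow> norm (a i) \<le> d * norm (b i)"
  shows "norm (lincomb a D) \<le> real (card D) * alpha1 e * alpha2 es * d * norm (lincomb b A)"
proof -
  have "norm (scl (a i) (e i)) \<le> d * (alpha2 es * norm (lincomb b A)) * alpha1 e" if "i \<in> D" for i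
  proof -
    have "norm (a i) \<le> d * (alpha2 es * norm (lincomb b A))"
      using dom[of i] norm_coeff_le[of A i b] assms that
      by (meson mult_left_mono order_trans subsetD)
    then show ?thesis
      unfolding norm_scl by (intro mult_mono norm_e_le)
        (use \<open>0 \<le> d\<close> alpha2_nonneg in auto)
  qed
  then have "norm (lincomb a D) \<le> real (card D) * (d * (alpha2 es * norm (lincomb b A)) * alpha1 e)"
    unfolding lincomb_def by (rule sum_norm_bound)
  then show ?thesis by (simp add: mult_ac)
qed

lemma norm_lincomb_le_remove:
  assumes "finite A" "B \<subseteq> A" "0 \<le> d" "0 \<le> C" "card (A - B) \<le> l"
    and dom: "\<And>i. i \<in> A \<Longrightarrow> norm (a i) \<le> d * norm (b i)"
    and B: "norm (lincomb a B) \<le> C * d * norm (lincomb b B)"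
  shows "norm (lincomb a A) \<le>
    (C + real l * alpha1 e * alpha2 es + C * real l * alpha1 e * alpha2 es) * d * norm (lincomb b A)"
proof -
  let ?y = "norm (lincomb b A)"
  let ?k = "real l * alpha1 e * alpha2 es"
  have k: "real (card (A - B)) * alpha1 e * alpha2 es \<le> ?k"
    using assms(5) by (intro mult_right_mono alpha1_nonneg alpha2_nonneg) auto
  have "norm (lincomb a (A - B)) \<le> real (card (A - B)) * alpha1 e * alpha2 es * d * ?y"
    by (rule norm_lincomb_le_card) (use assms in auto)
  also have "\<dots> \<le> ?k * d * ?y"
    by (rule mult_right_mono[OF mult_right_mono[OF k \<open>0 \<le> d\<close>] norm_ge_zero])
  finally have a: "norm (lincomb a (A - B)) \<le> ?k * d * ?y" .
  have "norm (lincomb b (A - B)) \<le> real (card (A - B)) * alpha1 e * alpha2 es * 1 * ?y"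
    by (rule norm_lincomb_le_card) (use assms in auto)
  also have "\<dots> \<le> ?k * ?y"
    by (rule mult_right_mono[OF _ norm_ge_zero]) (use k in simp)
  finally have "norm (lincomb b B) \<le> ?y + ?k * ?y"
    using lincomb_split[OF assms(1,2), of b] norm_triangle_ineq4[of "lincomb b A" "lincomb b (A - B)"]
    by simp
  then have "C * d * norm (lincomb b B) \<le> C * d * (?y + ?k * ?y)"
    using assms by (intro mult_left_mono) auto
  then have "norm (lincomb a A) \<le> ?k * d * ?y + C * d * (?y + ?k * ?y)"
    using lincomb_split[OF assms(1,2), of a] norm_triangle_ineq[of "lincomb a (A - B)" "lincomb a B"]
      a B by simp
  then show ?thesis by (simp add: algebra_simps)
qed

section \<open>Comparison by blocks for a Schauder basis\<close>

lemma norm_lincomb_initial_le: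
  assumes "partial_sum_bound scl e es K" "finite A"
  shows "norm (lincomb a (A \<inter> {..<s})) \<le> K * norm (lincomb a A)"
proof -
  have "(\<Sum>i<s. scl (es i (lincomb a A)) (e i)) = (\<Sum>i<s. if i \<in> A then scl (a i) (e i) else 0)"
    using assms(2) by (intro sum.cong) (auto simp: es_lincomb)
  also have "\<dots> = lincomb a (A \<inter> {..<s})"
    unfolding lincomb_def by (subst Int_commute) (simp add: sum.inter_restrict)
  finally show ?thesis
    using assms(1) unfolding partial_sum_bound_def by metis
qed

lemma norm_lincomb_interval_le:
  assumes "partial_sum_bound scl e es K" "finite A" "t \<le> s"
  shows "norm (lincomb a (A \<inter> {t..<s})) \<le> 2 * K * norm (lincomb a A)"
proof -
  have "lincomb a (A \<inter> {..<s}) = lincomb a (A \<inter> {..<s} - A \<inter> {..<t}) + lincomb a (A \<inter> {..<t})"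
    by (rule lincomb_split) (use assms in auto)
  moreover have "A \<inter> {..<s} - A \<inter> {..<t} = A \<inter> {t..<s}" by auto
  ultimately have "lincomb a (A \<inter> {t..<s}) = lincomb a (A \<inter> {..<s}) - lincomb a (A \<inter> {..<t})"
    by simp
  then show ?thesis
    using norm_triangle_ineq4[of "lincomb a (A \<inter> {..<s})" "lincomb a (A \<inter> {..<t})"]
      norm_lincomb_initial_le[OF assms(1,2), of a s] norm_lincomb_initial_le[OF assms(1,2), of a t]
    by simp
qed

lemma ex_initial_segment_card:
  fixes A :: "nat set"
  assumes "j \<le> card (A \<inter> {..<s})"
  shows "\<exists>t\<le>s. card (A \<inter> {..<t}) = j"
  using assms
proof (induction s)
  case (Suc s)
  have "A \<inter> {..<Suc s} = (if s \<in> A then insert s (A \<inter> {..<s}) else A \<inter> {..<s})"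
    by (auto simp: less_Suc_eq)
  then have "card (A \<inter> {..<Suc s}) \<le> Suc (card (A \<inter> {..<s}))" by simp
  then consider "j \<le> card (A \<inter> {..<s})" | "j = card (A \<inter> {..<Suc s})"
    using Suc.prems by linarith
  then show ?case
    using Suc.IH le_Suc_eq by cases auto
qed simp

text \<open>
  The induction on the number \<open>q\<close> of full blocks runs over initial segments of \<open>A\<close>, while the
  majorant stays on the whole of \<open>A\<close>; otherwise each induction step would
  multiply the constants of the earlier blocks by another factor \<open>K\<close>. The head of \<open>r\<close> elements is
  the base case; it is compared through the first \<open>m\<close> elements of \<open>A\<close>, which need not lie in the
  initial segment.
\<close>

lemma norm_lincomb_le_blocks:
  assumes K: "partial_sum_bound scl e es K"
    and A: "finite A" "m \<le> card A"
    and nonneg: "0 \<le> C" "0 \<le> d"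
    and blocks: "\<And>B. B \<subseteq> A \<Longrightarrow> card B = m \<Longrightarrow> norm (lincomb a B) \<le> C * d * norm (lincomb b B)"
    and "card (A \<inter> {..<s}) = q * m + r" "r < m"
  shows "norm (lincomb a (A \<inter> {..<s})) \<le> (K\<^sup>2 * C + 2 * real q * C * K) * d * norm (lincomb b A)"
  using assms(7)
proof (induction q arbitrary: s)
  case 0
  have K0: "0 \<le> K" using K by (simp add: partial_sum_bound_def)
  obtain u where "A \<subseteq> {..<u}" using A(1) by (metis finite_nat_iff_bounded)
  then have "m \<le> card (A \<inter> {..<u})" using A(2) by (simp add: Int_absorb2)
  then obtain t where t: "card (A \<inter> {..<t}) = m" using ex_initial_segment_card by blast
  have "s \<le> t"
  proof (rule ccontr)
    assume "\<not> s \<le> t"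
    then have "card (A \<inter> {..<t}) \<le> card (A \<inter> {..<s})"
      by (intro card_mono) auto
    then show False using t 0 \<open>r < m\<close> by simp
  qed
  then have "A \<inter> {..<s} = A \<inter> {..<t} \<inter> {..<s}" by auto
  then have "norm (lincomb a (A \<inter> {..<s})) \<le> K * norm (lincomb a (A \<inter> {..<t}))"
    using norm_lincomb_initial_le[OF K, of "A \<inter> {..<t}" a s] by simp
  also have "\<dots> \<le> K * (C * d * norm (lincomb b (A \<inter> {..<t})))"
    using K0 blocks[OF _ t] by (intro mult_left_mono) auto
  also have "\<dots> \<le> K * (C * d * (K * norm (lincomb b A)))"
    using K0 nonneg by (intro mult_left_mono norm_lincomb_initial_le K A) auto
  finally show ?case by (simp add: power2_eq_square mult_ac)
next
  case (Suc q)
  have "q * m + r \<le> card (A \<inter> {..<s})" using Suc.prems by simp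
  then obtain t where t: "t \<le> s" "card (A \<inter> {..<t}) = q * m + r"
    using ex_initial_segment_card by blast
  have eq: "A \<inter> {..<s} - A \<inter> {..<t} = A \<inter> {t..<s}" by auto
  have sub: "A \<inter> {..<t} \<subseteq> A \<inter> {..<s}" using t(1) by auto
  have "card (A \<inter> {t..<s}) = m"
    using card_Diff_subset[OF _ sub] Suc.prems t(2) eq by simp
  then have "norm (lincomb a (A \<inter> {t..<s})) \<le> C * d * norm (lincomb b (A \<inter> {t..<s}))"
    by (intro blocks) auto
  also have "\<dots> \<le> C * d * (2 * K * norm (lincomb b A))"
    using nonneg by (intro mult_left_mono norm_lincomb_interval_le K A t) auto
  finally have "norm (lincomb a (A \<inter> {t..<s})) \<le> C * d * (2 * K * norm (lincomb b A))" .
  moreover have "lincomb a (A \<inter> {..<s}) = lincomb a (A \<inter> {t..<s}) + lincomb a (A \<inter> {..<t})"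
    using lincomb_split[OF _ sub] eq by simp
  ultimately have "norm (lincomb a (A \<inter> {..<s})) \<le>
      C * d * (2 * K * norm (lincomb b A)) + (K\<^sup>2 * C + 2 * real q * C * K) * d * norm (lincomb b A)"
    using Suc.IH[OF t(2)] norm_triangle_ineq[of "lincomb a (A \<inter> {t..<s})" "lincomb a (A \<inter> {..<t})"]
    by simp
  then show ?case by (simp add: algebra_simps)
qed

section \<open>From comparisons to the UL property\<close>

text \<open>
  The loss is described by a function \<open>F\<close> of the comparison constant because the two inequalities of
  the UL property are transferred independently, each with its own constant.
\<close>

lemma UL_of_comparison:
  assumes ul: "UL_on scl e N C1 C2" and N: "0 \<notin> N"
    and F_pos: "\<And>C. 0 < C \<Longrightarrow> 0 < F C"
    and F: "\<And>A a b C d. \<lbrakk>finite A; A \<noteq> {}; 0 < C; 0 \<le> d;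
        \<And>i. i \<in> A \<Longrightarrow> norm (a i) \<le> d * norm (b i);
        \<And>B. B \<subseteq> A \<Longrightarrow> card B \<in> N \<Longrightarrow> norm (lincomb a B) \<le> C * d * norm (lincomb b B)\<rbrakk>
        \<Longrightarrow> norm (lincomb a A) \<le> F C * d * norm (lincomb b A)"
  shows "UL scl e (F C1) (F C2)"
proof -
  have C: "0 < C1" "0 < C2" using ul by (auto simp: UL_on_def)
  have lower: "Min ((\<lambda>i. norm (a i)) ` B) * norm (\<Sum>i\<in>B. e i) \<le> C1 * norm (lincomb a B)"
    if "finite B" "card B \<in> N" for a B
    using ul that C unfolding UL_on_def lincomb_def by (auto simp: field_simps)
  have upper: "norm (lincomb a B) \<le> C2 * Max ((\<lambda>i. norm (a i)) ` B) * norm (\<Sum>i\<in>B. e i)"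
    if "finite B" "card B \<in> N" for a B
    using ul that unfolding UL_on_def lincomb_def by blast
  have main: "1 / F C1 * Min ((\<lambda>i. norm (a i)) ` A) * norm (\<Sum>i\<in>A. e i) \<le> norm (lincomb a A) \<and>
      norm (lincomb a A) \<le> F C2 * Max ((\<lambda>i. norm (a i)) ` A) * norm (\<Sum>i\<in>A. e i)"
    if A: "finite A" "card A \<ge> 1" for A a
  proof
    have ne: "A \<noteq> {}" using A by auto
    define \<mu> where "\<mu> = Min ((\<lambda>i. norm (a i)) ` A)"
    define M where "M = Max ((\<lambda>i. norm (a i)) ` A)"
    have \<mu>: "0 \<le> \<mu>" "\<And>i. i \<in> A \<Longrightarrow> \<mu> \<le> norm (a i)"
      using A(1) ne by (auto simp: \<mu>_def)
    have M: "\<And>i. i \<in> A \<Longrightarrow> norm (a i) \<le> M" using A(1) by (auto simp: M_def)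
    then have M0: "0 \<le> M" using ne by (meson ex_in_conv norm_ge_zero order_trans)
    have sub: "finite B" "B \<noteq> {}" if "B \<subseteq> A" "card B \<in> N" for B
      using that A(1) N finite_subset by (fastforce+)
    have "norm (lincomb (\<lambda>_. of_real \<mu>) A) \<le> F C1 * 1 * norm (lincomb a A)"
    proof (rule F)
      fix B assume B: "B \<subseteq> A" "card B \<in> N"
      have "\<mu> \<le> Min ((\<lambda>i. norm (a i)) ` B)"
        using sub[OF B] B(1) \<mu>(2) by auto
      then have "\<mu> * norm (\<Sum>i\<in>B. e i) \<le> Min ((\<lambda>i. norm (a i)) ` B) * norm (\<Sum>i\<in>B. e i)"
        by (intro mult_right_mono) auto
      then show "norm (lincomb (\<lambda>_. of_real \<mu>) B) \<le> C1 * 1 * norm (lincomb a B)"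
        using lower[OF sub(1)[OF B] B(2), of a] \<mu>(1) by (simp add: lincomb_of_real)
    qed (use A(1) ne C \<mu> in auto)
    then have "\<mu> * norm (\<Sum>i\<in>A. e i) \<le> F C1 * norm (lincomb a A)"
      using \<mu>(1) by (simp add: lincomb_of_real)
    then show "1 / F C1 * Min ((\<lambda>i. norm (a i)) ` A) * norm (\<Sum>i\<in>A. e i) \<le> norm (lincomb a A)"
      using F_pos[OF C(1)] by (simp add: \<mu>_def field_simps)
    have "norm (lincomb a A) \<le> F C2 * M * norm (lincomb (\<lambda>_. 1) A)"
    proof (rule F)
      fix B assume B: "B \<subseteq> A" "card B \<in> N"
      have "Max ((\<lambda>i. norm (a i)) ` B) \<le> M"
        using sub[OF B] B(1) M by auto
      then have "C2 * Max ((\<lambda>i. norm (a i)) ` B) * norm (\<Sum>i\<in>B. e i) \<le> C2 * M * norm (\<Sum>i\<in>B. e i)"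
        using C by (intro mult_right_mono mult_left_mono) auto
      then show "norm (lincomb a B) \<le> C2 * M * norm (lincomb (\<lambda>_. 1) B)"
        using upper[OF sub(1)[OF B] B(2), of a] by (simp add: lincomb_one)
    qed (use A(1) ne C M M0 in auto)
    then show "norm (lincomb a A) \<le> F C2 * Max ((\<lambda>i. norm (a i)) ` A) * norm (\<Sum>i\<in>A. e i)"
      by (simp add: lincomb_one M_def)
  qed
  then show ?thesis
    using F_pos C unfolding UL_def UL_on_def lincomb_def by auto
qed

text \<open>
  This isolates the dichotomy behind the maximum in the constants: sets smaller than \<open>n 0\<close> are
  handled by the triangle inequality, and a larger set has its cardinality in a gap
  \<open>[n k, n (k + 1))\<close>, where a comparison constant \<open>G C\<close> has to be supplied.
\<close>

lemma UL_of_gap_comparison: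
  assumes ul: "UL_on scl e (range n) C1 C2" and n: "strict_mono n" "\<forall>k. 0 < n k"
    and G_pos: "\<And>C. 0 < C \<Longrightarrow> 0 < G C"
    and G: "\<And>k A a b C d. \<lbrakk>finite A; n k \<le> card A; card A < n (Suc k); 0 < C; 0 \<le> d;
        \<And>i. i \<in> A \<Longrightarrow> norm (a i) \<le> d * norm (b i);
        \<And>B. B \<subseteq> A \<Longrightarrow> card B = n k \<Longrightarrow> norm (lincomb a B) \<le> C * d * norm (lincomb b B)\<rbrakk>
        \<Longrightarrow> norm (lincomb a A) \<le> G C * d * norm (lincomb b A)"
  shows "UL scl e (max ((real (n 0) - 1) * alpha1 e * alpha2 es) (G C1))
                  (max ((real (n 0) - 1) * alpha1 e * alpha2 es) (G C2))"
proof (rule UL_of_comparison[OF ul])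
  show "0 \<notin> range n" using n(2) by (metis less_irrefl rangeE)
  show "0 < max ((real (n 0) - 1) * alpha1 e * alpha2 es) (G C)" if "0 < C" for C
    using G_pos[OF that] by simp
  fix A :: "nat set" and a b :: "nat \<Rightarrow> 'f" and C d :: real
  assume A: "finite A" "A \<noteq> {}" and C: "0 < C" and d: "0 \<le> d"
    and dom: "\<And>i. i \<in> A \<Longrightarrow> norm (a i) \<le> d * norm (b i)"
    and B: "\<And>B. B \<subseteq> A \<Longrightarrow> card B \<in> range n \<Longrightarrow> norm (lincomb a B) \<le> C * d * norm (lincomb b B)"
  let ?s = "(real (n 0) - 1) * alpha1 e * alpha2 es"
  have "\<exists>c. c \<le> max ?s (G C) \<and> norm (lincomb a A) \<le> c * d * norm (lincomb b A)"
  proof (cases "card A < n 0")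
    case True
    then have "real (card A) \<le> real (n 0) - 1" by linarith
    then have "real (card A) * alpha1 e * alpha2 es \<le> ?s"
      by (intro mult_right_mono alpha1_nonneg alpha2_nonneg)
    then show ?thesis
      using norm_lincomb_le_card[OF A(1) subset_refl d, of a b] dom
      by (intro exI[of _ "real (card A) * alpha1 e * alpha2 es"]) auto
  next
    case False
    have "\<exists>k. n k \<le> card A \<and> card A < n (Suc k)"
    proof (rule ccontr)
      assume no: "\<not> ?thesis"
      have "n k \<le> card A" for k
        by (induction k) (use False no in \<open>auto simp: not_less\<close>)
      then show False
        using strict_mono_imp_increasing[OF n(1), of "Suc (card A)"]
        by (meson Suc_n_not_le_n order_trans)
    qed
    then obtain k where "n k \<le> card A" "card A < n (Suc k)" by blast
    then have "norm (lincomb a A) \<le> G C * d * norm (lincomb b A)"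
      by (intro G A C d dom B) auto
    then show ?thesis by (intro exI[of _ "G C"]) auto
  qed
  then obtain c where c: "c \<le> max ?s (G C)" "norm (lincomb a A) \<le> c * d * norm (lincomb b A)"
    by blast
  have "c * d * norm (lincomb b A) \<le> max ?s (G C) * d * norm (lincomb b A)"
    using c(1) d by (intro mult_right_mono) auto
  with c(2) show "norm (lincomb a A) \<le> max ?s (G C) * d * norm (lincomb b A)" by linarith
qed

lemma UL_additive_gaps:
  assumes ul: "UL_on scl e (range n) C1 C2" and n: "strict_mono n" "\<forall>k. 0 < n k"
    and gaps: "bounded_additive_gaps l n"
  shows "UL scl e
    (max ((real (n 0) - 1) * alpha1 e * alpha2 es)
         (C1 + real l * alpha1 e * alpha2 es + C1 * real l * alpha1 e * alpha2 es))
    (max ((real (n 0) - 1) * alpha1 e * alpha2 es)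
         (C2 + real l * alpha1 e * alpha2 es + C2 * real l * alpha1 e * alpha2 es))"
proof (rule UL_of_gap_comparison[OF ul n])
  fix C :: real assume C: "0 < C"
  then show "0 < C + real l * alpha1 e * alpha2 es + C * real l * alpha1 e * alpha2 es"
    using alpha1_nonneg alpha2_nonneg by (intro add_pos_nonneg) auto
  fix k A and a b :: "nat \<Rightarrow> 'f" and d :: real
  assume A: "finite A" "n k \<le> card A" "card A < n (Suc k)" and d: "0 \<le> d"
    and dom: "\<And>i. i \<in> A \<Longrightarrow> norm (a i) \<le> d * norm (b i)"
    and hyp: "\<And>B. B \<subseteq> A \<Longrightarrow> card B = n k \<Longrightarrow> norm (lincomb a B) \<le> C * d * norm (lincomb b B)"
  obtain B where B: "B \<subseteq> A" "card B = n k"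
    using obtain_subset_with_card_n[OF A(2)] by metis
  have "real (n (Suc k)) - real (n k) \<le> real l"
    using gaps by (simp add: bounded_additive_gaps_def)
  then have "card (A - B) \<le> l"
    using A B by (simp add: card_Diff_subset finite_subset)
  then show "norm (lincomb a A) \<le>
      (C + real l * alpha1 e * alpha2 es + C * real l * alpha1 e * alpha2 es) * d * norm (lincomb b A)"
    using norm_lincomb_le_remove[OF A(1) B(1) d] C dom hyp[OF B] by simp
qed

lemma UL_quotient_gaps:
  assumes ul: "UL_on scl e (range n) C1 C2" and n: "strict_mono n" "\<forall>k. 0 < n k"
    and gaps: "bounded_quotient_gaps l n" and l: "1 \<le> l"
    and K: "partial_sum_bound scl e es K"
  shows "UL scl e
    (max ((real (n 0) - 1) * alpha1 e * alpha2 es) (K\<^sup>2 * C1 + 2 * (real l - 1) * C1 * K))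
    (max ((real (n 0) - 1) * alpha1 e * alpha2 es) (K\<^sup>2 * C2 + 2 * (real l - 1) * C2 * K))"
proof (rule UL_of_gap_comparison[OF ul n])
  have K0: "0 < K" using K by (simp add: partial_sum_bound_def)
  fix C :: real assume C: "0 < C"
  then show "0 < K\<^sup>2 * C + 2 * (real l - 1) * C * K"
    using K0 l by (intro add_pos_nonneg) auto
  fix k A and a b :: "nat \<Rightarrow> 'f" and d :: real
  assume A: "finite A" "n k \<le> card A" "card A < n (Suc k)" and d: "0 \<le> d"
    and hyp: "\<And>B. B \<subseteq> A \<Longrightarrow> card B = n k \<Longrightarrow> norm (lincomb a B) \<le> C * d * norm (lincomb b B)"
  have pos: "0 < n k" using n(2) by simp
  have "real (n (Suc k)) \<le> real (l * n k)"
    using spec[OF gaps[unfolded bounded_quotient_gaps_def], of k] pos by (simp add: pos_divide_le_eq)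
  then have card: "card A < l * n k" using A(3) by linarith
  define q where "q = card A div n k"
  have "q < l" unfolding q_def using card by (simp add: less_mult_imp_div_less)
  obtain u where "A \<subseteq> {..<u}" using A(1) by (metis finite_nat_iff_bounded)
  then have Au: "A \<inter> {..<u} = A" by blast
  have "norm (lincomb a (A \<inter> {..<u})) \<le> (K\<^sup>2 * C + 2 * real q * C * K) * d * norm (lincomb b A)"
  proof (rule norm_lincomb_le_blocks[OF K A(1,2) _ d])
    show "card (A \<inter> {..<u}) = q * n k + card A mod n k"
      unfolding Au q_def by (simp only: div_mult_mod_eq)
    show "norm (lincomb a B) \<le> C * d * norm (lincomb b B)" if "B \<subseteq> A" "card B = n k" for B
      by (rule hyp[OF that])
    show "0 \<le> C" using C by simp
    show "card A mod n k < n k" using pos by simp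
  qed
  then have "norm (lincomb a A) \<le> (K\<^sup>2 * C + 2 * real q * C * K) * d * norm (lincomb b A)"
    by (simp only: Au)
  also have "\<dots> \<le> (K\<^sup>2 * C + 2 * (real l - 1) * C * K) * d * norm (lincomb b A)"
    using \<open>q < l\<close> C K0 d by (intro mult_right_mono add_left_mono) auto
  finally show "norm (lincomb a A) \<le>
      (K\<^sup>2 * C + 2 * (real l - 1) * C * K) * d * norm (lincomb b A)" .
qed

end

theorem proposition2p4:
  fixes scl :: "'f::real_normed_field \<Rightarrow> 'x::banach \<Rightarrow> 'x"
    and e :: "nat \<Rightarrow> 'x" and es :: "nat \<Rightarrow> 'x \<Rightarrow> 'f"
    and n :: "nat \<Rightarrow> nat" and C1 C2 :: real
  assumes "separable_inf_dim_banach_space scl"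
    and "is_basis scl e es"
    and "strict_mono n" and "\<forall>k. 0 < n k"
    and "UL_on scl e (range n) C1 C2"
  shows
    "(\<forall>l\<ge>2. bounded_additive_gaps l n \<longrightarrow>
        (\<exists>C1' C2'. UL scl e C1' C2' \<and>
           C1' \<le> max ((real (n 0) - 1) * alpha1 e * alpha2 es)
                      (C1 + real l * alpha1 e * alpha2 es + C1 * real l * alpha1 e * alpha2 es) \<and>
           C2' \<le> max ((real (n 0) - 1) * alpha1 e * alpha2 es)
                      (C2 + real l * alpha1 e * alpha2 es + C2 * real l * alpha1 e * alpha2 es)))
     \<and>
     (\<forall>l\<ge>2. \<forall>K. bounded_quotient_gaps l n \<and> is_schauder scl e es \<and> is_basis_constant scl e es K \<longrightarrow>
        (\<exists>C1' C2'. UL scl e C1' C2' \<and>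
           C1' \<le> max ((real (n 0) - 1) * alpha1 e * alpha2 es)
                      (K\<^sup>2 * C1 + 2 * (real l - 1) * C1 * K) \<and>
           C2' \<le> max ((real (n 0) - 1) * alpha1 e * alpha2 es)
                      (K\<^sup>2 * C2 + 2 * (real l - 1) * C2 * K)))"
proof -
  interpret S: separable_inf_dim_banach_space scl by (rule assms(1))
  interpret basis_of_banach_space scl e es by unfold_locales (rule assms(2))
  show ?thesis
  proof (intro conjI allI impI)
    fix l assume "bounded_additive_gaps l n"
    note ul = UL_additive_gaps[OF assms(5,3,4) this]
    show "\<exists>C1' C2'. UL scl e C1' C2' \<and>
           C1' \<le> max ((real (n 0) - 1) * alpha1 e * alpha2 es)
                      (C1 + real l * alpha1 e * alpha2 es + C1 * real l * alpha1 e * alpha2 es) \<and>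
           C2' \<le> max ((real (n 0) - 1) * alpha1 e * alpha2 es)
                      (C2 + real l * alpha1 e * alpha2 es + C2 * real l * alpha1 e * alpha2 es)"
      by (rule exI, rule exI, intro conjI, rule ul) (rule order_refl)+
  next
    fix l :: nat and K
    assume "2 \<le> l"
      and "bounded_quotient_gaps l n \<and> is_schauder scl e es \<and> is_basis_constant scl e es K"
    then have "bounded_quotient_gaps l n" "1 \<le> l" "partial_sum_bound scl e es K"
      by (simp_all add: is_basis_constant_def)
    note ul = UL_quotient_gaps[OF assms(5,3,4) this]
    show "\<exists>C1' C2'. UL scl e C1' C2' \<and>
           C1' \<le> max ((real (n 0) - 1) * alpha1 e * alpha2 es)
                      (K\<^sup>2 * C1 + 2 * (real l - 1) * C1 * K) \<and>
           C2' \<le> max ((real (n 0) - 1) * alpha1 e * alpha2 es)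
                      (K\<^sup>2 * C2 + 2 * (real l - 1) * C2 * K)"
      by (rule exI, rule exI, intro conjI, rule ul) (rule order_refl)+
  qed
qed

end
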